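(* Let $M=\{(x,y,z)\in\mathbb{C}^3: x^2+y^2+z^2=3xyz\}$ be the Markov surface with the holomorphic symplectic form $\omega=\frac{dx\wedge dy}{2z-3xy}$ on its regular part, and let $G$ be the group of holomorphic symplectic automorphisms of $M$. Then the set of ordered Markov triples $\{(x,y,z)\in\mathbb{N}^3 : x^2+y^2+z^2=3xyz,\ x\le y\le z\}$ is a $G$-tame subset of $M$.
   Context: $\mathbb{N}=\{1,2,3,\dots\}$. A holomorphic symplectic automorphism of $M$ is a holomorphic automorphism $F$ with $F^*\omega=\omega$ on $M_{\mathrm{reg}}$. For a group $G$ acting on a normal reduced complex space $X$ by holomorphic automorphisms, an infinite closed discrete subset $A\subset X_{\mathrm{reg}}$ is called $G$-tame if for every injective map $\imath\colon A\to A$ there exists $F\in G$ with $F|_A=\imath$. *)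

theory Defs
  imports "HOL-Analysis.Analysis"
begin

definition mk3 :: "complex \<Rightarrow> complex \<Rightarrow> complex \<Rightarrow> complex^3" where
  "mk3 a b c = (\<chi> i. if i = 1 then a else if i = 2 then b else c)"

definition markov_f :: "complex^3 \<Rightarrow> complex" where
  "markov_f p = (p$1)^2 + (p$2)^2 + (p$3)^2 - 3 * p$1 * p$2 * p$3"

definition markov_surface :: "(complex^3) set" where
  "markov_surface = {p. (p$1)^2 + (p$2)^2 + (p$3)^2 = 3 * p$1 * p$2 * p$3}"

text \<open>Gradient of f; the regular part of the (reduced) hypersurface M is where it does not vanish.\<close>
definition markov_grad :: "complex^3 \<Rightarrow> complex^3" where
  "markov_grad p = mk3 (2*p$1 - 3*p$2*p$3) (2*p$2 - 3*p$1*p$3) (2*p$3 - 3*p$1*p$2)"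

definition markov_reg :: "(complex^3) set" where
  "markov_reg = {p \<in> markov_surface. markov_grad p \<noteq> 0}"

definition markov_tangent :: "complex^3 \<Rightarrow> (complex^3) set" where
  "markov_tangent p = {u. (\<Sum>i\<in>UNIV. markov_grad p $ i * u $ i) = 0}"

text \<open>The symplectic form omega = dx/\dy/(2z-3xy) on M_reg, evaluated on tangent vectors.
  Where 2z-3xy = 0 it is given by the equal residue expressions dy/\dz/(2x-3yz) resp.
  dz/\dx/(2y-3xz) (Poincare residue of dx/\dy/\dz / f).\<close>
definition markov_omega :: "complex^3 \<Rightarrow> complex^3 \<Rightarrow> complex^3 \<Rightarrow> complex" where
  "markov_omega p u v =
     (if 2*p$3 - 3*p$1*p$2 \<noteq> 0 then (u$1 * v$2 - u$2 * v$1) / (2*p$3 - 3*p$1*p$2)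
      else if 2*p$1 - 3*p$2*p$3 \<noteq> 0 then (u$2 * v$3 - u$3 * v$2) / (2*p$1 - 3*p$2*p$3)
      else (u$3 * v$1 - u$1 * v$3) / (2*p$2 - 3*p$1*p$3))"

definition holo3 :: "(complex^3 \<Rightarrow> complex^3) \<Rightarrow> (complex^3) set \<Rightarrow> bool" where
  "holo3 g U \<longleftrightarrow> (\<forall>p\<in>U. \<exists>L. (g has_derivative L) (at p) \<and> (\<forall>c u. L (c *s u) = c *s L u))"

definition holo_map_on :: "(complex^3) set \<Rightarrow> (complex^3 \<Rightarrow> complex^3) \<Rightarrow> bool" where
  "holo_map_on X F \<longleftrightarrow> F ` X \<subseteq> X \<and>
     (\<forall>p\<in>X. \<exists>U g. open U \<and> p \<in> U \<and> holo3 g U \<and> (\<forall>q\<in>X \<inter> U. g q = F q))"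

definition holo_aut :: "(complex^3) set \<Rightarrow> (complex^3 \<Rightarrow> complex^3) \<Rightarrow> bool" where
  "holo_aut X F \<longleftrightarrow> bij_betw F X X \<and> holo_map_on X F \<and> holo_map_on X (inv_into X F)"

definition markov_symplectic :: "(complex^3 \<Rightarrow> complex^3) \<Rightarrow> bool" where
  "markov_symplectic F \<longleftrightarrow>
     (\<forall>p\<in>markov_reg. \<forall>U g L. open U \<and> p \<in> U \<and> holo3 g U
        \<and> (\<forall>q\<in>markov_surface \<inter> U. g q = F q) \<and> (g has_derivative L) (at p) \<longrightarrow>
        (\<forall>u\<in>markov_tangent p. \<forall>v\<in>markov_tangent p.
            markov_omega (F p) (L u) (L v) = markov_omega p u v))"

text \<open>The group G of holomorphic symplectic automorphisms of M (as a set of maps; values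
  off M are irrelevant).\<close>
definition markov_G :: "(complex^3 \<Rightarrow> complex^3) set" where
  "markov_G = {F. holo_aut markov_surface F \<and> markov_symplectic F}"

definition tame :: "(complex^3) set \<Rightarrow> (complex^3) set \<Rightarrow> (complex^3 \<Rightarrow> complex^3) set
                     \<Rightarrow> (complex^3) set \<Rightarrow> bool" where
  "tame X Xreg G A \<longleftrightarrow>
     infinite A \<and> A \<subseteq> Xreg \<and> closedin (top_of_set X) A \<and>
     (\<forall>a\<in>A. \<exists>e>0. ball a e \<inter> A = {a}) \<and>
     (\<forall>\<iota>. \<iota> ` A \<subseteq> A \<and> inj_on \<iota> A \<longrightarrow> (\<exists>F\<in>G. \<forall>a\<in>A. F a = \<iota> a))"

definition ordered_markov_triples :: "(complex^3) set" where
  "ordered_markov_triples =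
     {mk3 (of_nat x) (of_nat y) (of_nat z) | x y z :: nat.
        1 \<le> x \<and> 1 \<le> y \<and> 1 \<le> z \<and> x^2 + y^2 + z^2 = 3*x*y*z \<and> x \<le> y \<and> y \<le> z}"

end

theory Submission
  imports Defs "HOL-Complex_Analysis.Cauchy_Integral_Formula"
begin

text \<open>
  For fixed \<open>x\<close> the equation is a conic in \<open>(y, z)\<close>, and the Hamiltonian flow of the function \<open>x\<close> is
  linear in \<open>(y, z)\<close>: its generator \<open>A\<close> satisfies \<open>A\<^sup>2 = (9x\<^sup>2 - 4) I\<close>, so the time-\<open>t\<close> map is \<open>c I + s A\<close>
  with \<open>c\<^sup>2 - (9x\<^sup>2 - 4) s\<^sup>2 = 1\<close>. Letting \<open>t\<close> be an entire function of \<open>x\<close> yields automorphisms of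
  \<open>\<complex>\<^sup>3\<close> preserving both \<open>f\<close> and the volume form, hence the residue form \<open>\<omega>\<close>; by interpolation the time can
  be prescribed at every natural number. The flows of \<open>y\<close> and \<open>z\<close> are conjugate to it by the cyclic
  rotation of the coordinates.

  A flow of \<open>z\<close> that applies on each fibre a high power of the Vieta map \<open>(x, y) \<mapsto> (y, 3zy - x)\<close>
  moves the ordered triples to integer points whose \<open>x\<close>-coordinates are pairwise distinct, and likewise
  their \<open>y\<close>-coordinates. If \<open>a\<close> goes to \<open>(X\<^sub>a, Y\<^sub>a, z\<^sub>a)\<close> and \<open>b\<close> is the prescribed image of \<open>a\<close>, then a
  flow of \<open>x\<close> takes this to some \<open>(X\<^sub>a, Y\<^sub>b, \<zeta>)\<close>, a flow of \<open>y\<close> takes that to \<open>(X\<^sub>b, Y\<^sub>b, z\<^sub>b)\<close>, and undoing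
  the first map gives \<open>b\<close>.
\<close>

section \<open>Entire interpolation at the natural numbers\<close>

text \<open>The Lagrange polynomial with nodes 0, ..., n is multiplied by
  \<open>(z / n) ^ m\<close>. This factor is 1 at n and at most \<open>(1/2) ^ m\<close> in modulus
  on the disc of radius n/2, so a large m beats any bound for the polynomial there.\<close>

lemma exists_entire_vanishing_below:
  fixes v :: complex and n :: nat
  shows "\<exists>g. g holomorphic_on UNIV \<and> (\<forall>k<n. g (of_nat k) = 0) \<and> g (of_nat n) = v \<and>
             (0 < n \<longrightarrow> (\<forall>z. norm z \<le> of_nat n / 2 \<longrightarrow> norm (g z) \<le> (1/2) ^ n))"
proof (cases "n = 0")
  case True
  then show ?thesis by (intro exI[of _ "\<lambda>_. v"]) auto
next
  case False
  define q :: "complex \<Rightarrow> complex"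
    where "q z = v * (\<Prod>k<n. (z - of_nat k) / (of_nat n - of_nat k))" for z
  have hol: "q holomorphic_on UNIV"
    unfolding q_def by (intro holomorphic_intros) auto
  have "compact (q ` cball 0 (of_nat n / 2))"
    by (intro compact_continuous_image holomorphic_on_imp_continuous_on
          holomorphic_on_subset[OF hol]) auto
  then obtain B where "0 < B" and B_ball: "\<forall>z\<in>cball 0 (of_nat n / 2). norm (q z) \<le> B"
    using bounded_pos[of "q ` cball 0 (of_nat n / 2)"] compact_imp_bounded by auto
  have B: "norm (q z) \<le> B" if "norm z \<le> of_nat n / 2" for z
    using B_ball that by simp
  obtain m where m: "(1/2) ^ m < (1/2 :: real) ^ n / B"
    using real_arch_pow_inv[of "(1/2 :: real) ^ n / B" "1/2"] \<open>0 < B\<close> by auto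
  define g where "g z = q z * (z / of_nat n) ^ m" for z
  have "norm (g z) \<le> (1/2) ^ n" if z: "norm z \<le> of_nat n / 2" for z
  proof -
    have "norm (z / of_nat n) \<le> 1/2"
      using z False by (simp add: norm_divide field_simps)
    then have "norm ((z / of_nat n) ^ m) \<le> (1/2) ^ m"
      unfolding norm_power by (intro power_mono) auto
    then have "norm (g z) \<le> B * (1/2) ^ m"
      unfolding g_def norm_mult using B[OF z] \<open>0 < B\<close> by (intro mult_mono) auto
    also have "\<dots> \<le> (1/2) ^ n"
      using m \<open>0 < B\<close> by (simp add: field_simps)
    finally show ?thesis .
  qed
  moreover have "g holomorphic_on UNIV"
    unfolding g_def using False by (intro holomorphic_intros hol) auto
  moreover have "g (of_nat k) = 0" if "k < n" for k
  proof -
    have "(\<Prod>j<n. (of_nat k - of_nat j) / (of_nat n - of_nat j) :: complex) = 0"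
      using that by (intro prod_zero) auto
    then show ?thesis by (simp add: g_def q_def)
  qed
  moreover have "g (of_nat n) = v"
  proof -
    have "(\<Prod>j<n. (of_nat n - of_nat j) / (of_nat n - of_nat j) :: complex) = 1"
      by (intro prod.neutral) auto
    then show ?thesis using False by (simp add: g_def q_def)
  qed
  ultimately show ?thesis by blast
qed

text \<open>Newton interpolation: the n-th term corrects the value at n without disturbing the
  values at smaller naturals, and on a fixed disc almost all terms are dominated by a geometric
  series.\<close>

lemma entire_interpolation_nat:
  fixes t :: "nat \<Rightarrow> complex"
  obtains h where "h holomorphic_on UNIV" "\<And>n. h (of_nat n) = t n"
proof -
  obtain G :: "nat \<Rightarrow> complex \<Rightarrow> complex \<Rightarrow> complex" where
    G: "G n v holomorphic_on UNIV" "k < n \<Longrightarrow> G n v (of_nat k) = 0" "G n v (of_nat n) = v"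
       "0 < n \<Longrightarrow> norm z \<le> of_nat n / 2 \<Longrightarrow> norm (G n v z) \<le> (1/2) ^ n" for n v k z
    using exists_entire_vanishing_below by metis
  \<comment> \<open>Each correction depends on the value of the preceding partial sum, so the
    recursion runs on partial sums rather than on terms.\<close>
  define P :: "nat \<Rightarrow> complex \<Rightarrow> complex" where
    "P = rec_nat (\<lambda>_. 0) (\<lambda>n p z. p z + G n (t n - p (of_nat n)) z)"
  define g where "g n = G n (t n - P n (of_nat n))" for n
  have P_0: "P 0 = (\<lambda>_. 0)" and P_Suc: "P (Suc n) = (\<lambda>z. P n z + g n z)" for n
    by (simp_all add: P_def g_def)
  have P_sum: "P N z = (\<Sum>n<N. g n z)" for N z
    by (induction N) (simp_all add: P_0 P_Suc)
  have P_hol: "P n holomorphic_on UNIV" for n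
    by (induction n) (auto simp: P_0 P_Suc g_def intro!: holomorphic_intros G)
  have P_val: "P (Suc (k + m)) (of_nat k) = t k" for k m
  proof (induction m)
    case 0
    show ?case by (simp add: P_Suc g_def G(3))
  next
    case (Suc m)
    then show ?case by (simp add: P_Suc[of "Suc (k + m)"] g_def G(2))
  qed
  define h where "h z = (\<Sum>n. g n z)" for z
  have ulim: "uniform_limit (cball 0 R) P h sequentially" for R
  proof -
    obtain N where N: "2 * R + 1 \<le> real N"
      using real_arch_simple by blast
    have "\<forall>\<^sub>F n in sequentially. \<forall>z\<in>cball 0 R. norm (g n z) \<le> (1/2) ^ n"
      using eventually_ge_at_top[of "max 1 N"]
    proof eventually_elim
      case (elim n)
      then have "real N \<le> real n" "0 < n" by auto
      with N have "R \<le> real n / 2" by linarith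
      with \<open>0 < n\<close> show ?case unfolding g_def by (auto intro!: G(4))
    qed
    then have "uniform_limit (cball 0 R) (\<lambda>n z. \<Sum>i<n. g i z) h sequentially"
      unfolding h_def by (rule Weierstrass_m_test_ev) (simp add: summable_geometric)
    moreover have "(\<lambda>n z. \<Sum>i<n. g i z) = P"
      by (intro ext) (rule P_sum[symmetric])
    ultimately show ?thesis by simp
  qed
  show thesis
  proof
    have "h holomorphic_on ball 0 R" for R
      by (rule holomorphic_uniform_limit[OF _ ulim[of R]])
         (auto intro!: always_eventually holomorphic_on_subset[OF P_hol] holomorphic_on_imp_continuous_on)
    then have "h field_differentiable at z" for z
      using holomorphic_onD[of h "ball 0 (norm z + 1)" z]
      by (simp add: at_within_open[of z "ball 0 (norm z + 1)"])
    then show "h holomorphic_on UNIV"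
      by (simp add: holomorphic_on_def)
    show "h (of_nat n) = t n" for n
    proof -
      have "(\<lambda>N. P N (of_nat n)) \<longlonglongrightarrow> h (of_nat n)"
        using ulim[of "real n"] by (rule tendsto_uniform_limitI) auto
      moreover have "(\<lambda>N. P N (of_nat n)) \<longlonglongrightarrow> t n"
        using P_val[of n] by (intro tendsto_eventually eventually_sequentiallyI[of "Suc n"])
          (metis add_Suc le_Suc_ex)
      ultimately show ?thesis by (rule LIMSEQ_unique)
    qed
  qed
qed

section \<open>Hyperbolic functions of a square root\<close>

text \<open>With the next definition, cosh r and sinh r / r as entire functions of w = r^2. The
  power series avoid any choice of a branch of the root.\<close>

definition cosh_sqrt :: "complex \<Rightarrow> complex" where
  "cosh_sqrt w = (\<Sum>n. inverse (fact (2 * n)) * w ^ n)"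

definition sinhc_sqrt :: "complex \<Rightarrow> complex" where
  "sinhc_sqrt w = (\<Sum>n. inverse (fact (2 * n + 1)) * w ^ n)"

lemma summable_inverse_fact_power:
  fixes w :: complex
  assumes "\<And>n. n \<le> r n"
  shows "summable (\<lambda>n. inverse (fact (r n)) * w ^ n)"
proof (rule summable_comparison_test')
  show "summable (\<lambda>n. inverse (fact n) * norm w ^ n)"
    by (rule summable_exp)
  show "norm (inverse (fact (r n)) * w ^ n) \<le> inverse (fact n) * norm w ^ n" for n
    using fact_mono[OF assms[of n], where 'a = real]
    by (auto simp: norm_mult norm_power norm_inverse intro!: mult_right_mono le_imp_inverse_le)
qed

lemma cosh_sqrt_holomorphic: "cosh_sqrt holomorphic_on UNIV"
  and sinhc_sqrt_holomorphic: "sinhc_sqrt holomorphic_on UNIV"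
  unfolding cosh_sqrt_def[abs_def] sinhc_sqrt_def[abs_def] holomorphic_on_def field_differentiable_def
  by ((intro ballI exI, rule DERIV_subset, rule termdiffs_strong_converges_everywhere,
        rule summable_inverse_fact_power, linarith, rule subset_UNIV)+)

lemma exp_eq_cosh_sqrt_sinhc_sqrt: "exp x = cosh_sqrt (x^2) + x * sinhc_sqrt (x^2)"
proof -
  have "(\<lambda>n. inverse (fact n) * x ^ n) sums exp x"
    using exp_converges[of x] by (simp add: scaleR_conv_of_real)
  from sums_group[OF this, of 2]
  have "(\<lambda>n. inverse (fact (2 * n)) * (x^2) ^ n + x * (inverse (fact (2 * n + 1)) * (x^2) ^ n)) sums exp x"
    by (simp add: atLeastLessThan_add_Un power_mult[symmetric] mult_ac)
  moreover have "(\<lambda>n. inverse (fact (2 * n)) * (x^2) ^ n + x * (inverse (fact (2 * n + 1)) * (x^2) ^ n))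
      sums (cosh_sqrt (x^2) + x * sinhc_sqrt (x^2))"
    unfolding cosh_sqrt_def sinhc_sqrt_def
    by (intro sums_add sums_mult summable_sums summable_inverse_fact_power) auto
  ultimately show ?thesis by (rule sums_unique2)
qed

lemma cosh_sqrt_square: "cosh_sqrt (x^2) = cosh x"
  and sinhc_sqrt_square: "x * sinhc_sqrt (x^2) = sinh x"
  using exp_eq_cosh_sqrt_sinhc_sqrt[of x] exp_eq_cosh_sqrt_sinhc_sqrt[of "- x"]
  by (simp_all add: cosh_field_def sinh_field_def)

lemma cosh_sqrt_pell: "(cosh_sqrt w)^2 - w * (sinhc_sqrt w)^2 = 1"
proof -
  have "(cosh_sqrt w)^2 - w * (sinhc_sqrt w)^2 = (cosh (csqrt w))^2 - (csqrt w * sinhc_sqrt w)^2"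
    using cosh_sqrt_square[of "csqrt w"] by (simp add: power_mult_distrib)
  also have "csqrt w * sinhc_sqrt w = sinh (csqrt w)"
    using sinhc_sqrt_square[of "csqrt w"] by simp
  finally show ?thesis by (simp add: cosh_square_eq)
qed

text \<open>With e a square root of d, the conic factors as (c + e s)(c - e s) = 1, and a logarithm
  of c + e s is e times the required time. For d = 0 the points with c = -1 would be missed.\<close>

lemma pell_parametrization:
  fixes c s d :: complex
  assumes "c^2 - d * s^2 = 1" "d \<noteq> 0"
  obtains t where "cosh_sqrt (t^2 * d) = c" "t * sinhc_sqrt (t^2 * d) = s"
proof -
  define e where "e = csqrt d"
  have e: "e^2 = d" "e \<noteq> 0" using assms by (auto simp: e_def)
  have prod: "(c + e * s) * (c - e * s) = 1"
    using assms e by (simp add: algebra_simps power2_eq_square)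
  then have "c + e * s \<noteq> 0" by auto
  define x where "x = Ln (c + e * s)"
  have ex: "exp x = c + e * s" using \<open>c + e * s \<noteq> 0\<close> by (simp add: x_def)
  then have "exp (- x) = c - e * s" using prod by (simp add: exp_minus inverse_unique)
  with ex have "cosh x = c" "sinh x = e * s"
    by (simp_all add: cosh_field_def sinh_field_def)
  moreover have "(x / e)^2 * d = x^2" using e assms(2) by (simp add: power_divide)
  ultimately show thesis
    using that[of "x / e"] e by (simp add: cosh_sqrt_square sinhc_sqrt_square)
qed

lemma cosh_sqrt_0: "cosh_sqrt 0 = 1" and sinhc_sqrt_0: "sinhc_sqrt 0 = 1"
  by (simp_all add: cosh_sqrt_def sinhc_sqrt_def)

section \<open>Volume-preserving shears\<close>

lemma mk3_nth [simp]: "mk3 a b c $ 1 = a" "mk3 a b c $ 2 = b" "mk3 a b c $ 3 = c"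
  by (simp_all add: mk3_def)

lemma vec3_eq_iff: "p = q \<longleftrightarrow> p$1 = q$1 \<and> p$2 = q$2 \<and> p$3 = q$3" for p q :: "complex^3"
  by (auto simp: vec_eq_iff forall_3)

lemma mk3_eq_axis: "mk3 a b c = axis 1 a + axis 2 b + axis 3 c"
  by (simp add: vec3_eq_iff axis_def)

lemma bounded_linear_axis: "bounded_linear (axis i :: complex \<Rightarrow> complex^3)"
  by (rule linear_conv_bounded_linear[THEN iffD1])
     (auto intro!: linearI simp: vec_eq_iff axis_def)

lemma has_derivative_mk3:
  assumes "(f has_derivative f') F" "(g has_derivative g') F" "(h has_derivative h') F"
  shows "((\<lambda>p. mk3 (f p) (g p) (h p)) has_derivative (\<lambda>u. mk3 (f' u) (g' u) (h' u))) F"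
  unfolding mk3_eq_axis
  by (intro has_derivative_add bounded_linear.has_derivative[OF bounded_linear_axis] assms)

lemma has_derivative_nth [derivative_intros]:
  "((\<lambda>p. p $ i) has_derivative (\<lambda>u. u $ i)) (at (p :: complex^3) within S)"
  by (rule bounded_linear_imp_has_derivative) (rule bounded_linear_vec_nth)

lemma has_derivative_entire_nth:
  assumes "(c has_field_derivative c') (at ((p :: complex^3) $ i))"
  shows "((\<lambda>p. c (p $ i)) has_derivative (\<lambda>u. c' * u $ i)) (at p)"
  using has_derivative_compose[OF has_derivative_nth, of c "(*) c'" p i UNIV] assms
  by (simp add: has_field_derivative_def)

definition det3 :: "complex^3 \<Rightarrow> complex^3 \<Rightarrow> complex^3 \<Rightarrow> complex" where
  "det3 u v w = (u$2 * v$3 - u$3 * v$2) * w$1 + (u$3 * v$1 - u$1 * v$3) * w$2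
              + (u$1 * v$2 - u$2 * v$1) * w$3"

text \<open>Preserving f on all of \<open>complex^3\<close>, not only its zero set, together with
  the volume form makes the residue of dx dy dz / f invariant.\<close>

definition markov_entire :: "(complex^3 \<Rightarrow> complex^3) \<Rightarrow> bool" where
  "markov_entire g \<longleftrightarrow> (\<forall>p. markov_f (g p) = markov_f p) \<and>
     (\<forall>p. \<exists>L. (g has_derivative L) (at p) \<and> (\<forall>c u. L (c *s u) = c *s L u) \<and>
        (\<forall>u v w. det3 (L u) (L v) (L w) = det3 u v w))"

definition markov_biholo :: "(complex^3 \<Rightarrow> complex^3) \<Rightarrow> (complex^3 \<Rightarrow> complex^3) \<Rightarrow> bool" where
  "markov_biholo g g' \<longleftrightarrow> markov_entire g \<and> markov_entire g' \<and> (\<forall>p. g' (g p) = p) \<and> (\<forall>p. g (g' p) = p)"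

lemma markov_entire_comp:
  assumes g: "markov_entire g" and h: "markov_entire h"
  shows "markov_entire (g \<circ> h)"
  unfolding markov_entire_def
proof (intro conjI allI)
  show "markov_f ((g \<circ> h) p) = markov_f p" for p
    using g h by (simp add: markov_entire_def)
  fix p
  obtain K where K: "(h has_derivative K) (at p)" "\<And>c u. K (c *s u) = c *s K u"
      "\<And>u v w. det3 (K u) (K v) (K w) = det3 u v w"
    using h unfolding markov_entire_def by metis
  obtain L where L: "(g has_derivative L) (at (h p))" "\<And>c u. L (c *s u) = c *s L u"
      "\<And>u v w. det3 (L u) (L v) (L w) = det3 u v w"
    using g unfolding markov_entire_def by metis
  show "\<exists>L. (g \<circ> h has_derivative L) (at p) \<and> (\<forall>c u. L (c *s u) = c *s L u) \<and>
          (\<forall>u v w. det3 (L u) (L v) (L w) = det3 u v w)"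
    by (rule exI[of _ "L \<circ> K"]) (simp add: diff_chain_at[OF K(1) L(1)] K(2,3) L(2,3))
qed

lemma markov_biholo_sym: "markov_biholo g g' \<Longrightarrow> markov_biholo g' g"
  by (auto simp: markov_biholo_def)

lemma markov_biholo_comp:
  "markov_biholo g g' \<Longrightarrow> markov_biholo h h' \<Longrightarrow> markov_biholo (g \<circ> h) (h' \<circ> g')"
  by (auto simp: markov_biholo_def markov_entire_comp)

text \<open>A cyclic permutation is even and so preserves the volume form; a transposition would
  reverse its sign.\<close>

definition markov_rot :: "complex^3 \<Rightarrow> complex^3" where
  "markov_rot p = mk3 (p$2) (p$3) (p$1)"

lemma markov_entire_rot: "markov_entire markov_rot"
  unfolding markov_entire_def
proof (intro conjI allI)
  show "markov_f (markov_rot p) = markov_f p" for p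
    by (simp add: markov_f_def markov_rot_def algebra_simps)
  fix p
  have "(markov_rot has_derivative markov_rot) (at p)"
    unfolding markov_rot_def[abs_def] by (intro has_derivative_mk3 has_derivative_nth)
  then show "\<exists>L. (markov_rot has_derivative L) (at p) \<and> (\<forall>c u. L (c *s u) = c *s L u) \<and>
          (\<forall>u v w. det3 (L u) (L v) (L w) = det3 u v w)"
    by (intro exI[of _ markov_rot] conjI) (auto simp: markov_rot_def det3_def vec3_eq_iff algebra_simps)
qed

lemma markov_biholo_rot: "markov_biholo markov_rot (markov_rot \<circ> markov_rot)"
  by (auto simp: markov_biholo_def markov_entire_rot markov_entire_comp)
     (auto simp: markov_rot_def vec3_eq_iff)

text \<open>The matrix \<open>c I + s A\<close> acting on \<open>(y, z)\<close>, where \<open>A\<close> generates the Hamiltonian flow of \<open>x\<close>.\<close>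
definition markov_shear :: "complex \<Rightarrow> complex \<Rightarrow> complex^3 \<Rightarrow> complex^3" where
  "markov_shear c s p = mk3 (p$1) (c * p$2 + s * (2 * p$3 - 3 * p$1 * p$2))
                                  (c * p$3 - s * (2 * p$2 - 3 * p$1 * p$3))"

text \<open>For fixed x the matrix c I + s A multiplies the quadratic form y^2 + z^2 - 3xyz by its
  determinant, which is the Pell expression.\<close>

lemma markov_f_shear:
  assumes "c^2 - (9 * (p$1)^2 - 4) * s^2 = 1"
  shows "markov_f (markov_shear c s p) = markov_f p"
proof -
  have "markov_f (markov_shear c s p) = (p$1)^2 +
     (c^2 - (9 * (p$1)^2 - 4) * s^2) * ((p$2)^2 + (p$3)^2 - 3 * p$1 * p$2 * p$3)"
    by (simp add: markov_f_def markov_shear_def algebra_simps power2_eq_square)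
  then show ?thesis
    unfolding assms by (simp add: markov_f_def algebra_simps)
qed

lemma markov_shear_inverse:
  assumes "c^2 - (9 * (p$1)^2 - 4) * s^2 = 1"
  shows "markov_shear c (- s) (markov_shear c s p) = p"
proof -
  have "markov_shear c (- s) (markov_shear c s p) =
      mk3 (p$1) ((c^2 - (9 * (p$1)^2 - 4) * s^2) * p$2) ((c^2 - (9 * (p$1)^2 - 4) * s^2) * p$3)"
    by (simp add: markov_shear_def vec3_eq_iff algebra_simps power2_eq_square)
  then show ?thesis
    unfolding assms by (simp add: vec3_eq_iff)
qed

lemma markov_entire_shear:
  assumes hol: "c holomorphic_on UNIV" "s holomorphic_on UNIV"
    and pell: "\<And>x. (c x)^2 - (9 * x^2 - 4) * (s x)^2 = 1"
  shows "markov_entire (\<lambda>p. markov_shear (c (p$1)) (s (p$1)) p)"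
  unfolding markov_entire_def
proof (intro conjI allI)
  show "markov_f (markov_shear (c (p$1)) (s (p$1)) p) = markov_f p" for p
    by (rule markov_f_shear) (rule pell)
  fix p :: "complex^3"
  obtain c' where c': "(c has_field_derivative c') (at (p$1))"
    using hol(1) by (auto simp: holomorphic_on_def field_differentiable_def)
  obtain s' where s': "(s has_field_derivative s') (at (p$1))"
    using hol(2) by (auto simp: holomorphic_on_def field_differentiable_def)
  \<comment> \<open>The entries of c I + s A are a, b, -b, e, while \<alpha> and \<beta> are the
    x-derivatives of the last two components. These stand below the diagonal of the Jacobian, so its
    determinant is that of the 2 by 2 block.\<close>
  define a where "a = c (p$1) - 3 * p$1 * s (p$1)"
  define b where "b = 2 * s (p$1)"
  define e where "e = c (p$1) + 3 * p$1 * s (p$1)"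
  define \<alpha> where "\<alpha> = c' * p$2 + s' * (2 * p$3 - 3 * p$1 * p$2) - 3 * s (p$1) * p$2"
  define \<beta> where "\<beta> = c' * p$3 - s' * (2 * p$2 - 3 * p$1 * p$3) + 3 * s (p$1) * p$3"
  define L where "L u = mk3 (u$1) (\<alpha> * u$1 + a * u$2 + b * u$3) (\<beta> * u$1 - b * u$2 + e * u$3)"
    for u :: "complex^3"
  have det: "a * e + b^2 = 1"
    using pell[of "p$1"] by (simp add: a_def b_def e_def algebra_simps power2_eq_square)
  have "((\<lambda>p. markov_shear (c (p$1)) (s (p$1)) p) has_derivative L) (at p)"
    unfolding markov_shear_def L_def a_def b_def e_def \<alpha>_def \<beta>_def
    by (rule has_derivative_eq_rhs,
        (rule has_derivative_mk3 has_derivative_nth has_derivative_entire_nth[OF c']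
           has_derivative_entire_nth[OF s'] has_derivative_add has_derivative_diff
           has_derivative_mult has_derivative_const)+)
       (auto simp: fun_eq_iff vec3_eq_iff algebra_simps)
  moreover have "L (k *s u) = k *s L u" for k u
    by (simp add: L_def vec3_eq_iff algebra_simps)
  moreover have "det3 (L u) (L v) (L w) = (a * e + b^2) * det3 u v w" for u v w
    by (simp add: L_def det3_def) algebra
  ultimately show "\<exists>L. ((\<lambda>p. markov_shear (c (p$1)) (s (p$1)) p) has_derivative L) (at p) \<and>
      (\<forall>c u. L (c *s u) = c *s L u) \<and> (\<forall>u v w. det3 (L u) (L v) (L w) = det3 u v w)"
    unfolding det by auto
qed

text \<open>What is interpolated is the time, not c and s themselves: the Pell equation then holds
  at every complex x and not just at the naturals.\<close>

lemma markov_shear_interpolation: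
  fixes c s :: "nat \<Rightarrow> complex"
  assumes pell: "\<And>n. (c n)^2 - (9 * (of_nat n)^2 - 4) * (s n)^2 = 1"
  obtains g g' where "markov_biholo g g'"
    "\<And>p n. p$1 = of_nat n \<Longrightarrow> g p = markov_shear (c n) (s n) p"
proof -
  \<comment> \<open>The degenerate fibres x = 2/3 and x = -2/3 are not over naturals, so
    \<open>pell_parametrization\<close> applies at every n.\<close>
  have "9 * (of_nat n)^2 - 4 \<noteq> (0 :: complex)" for n
  proof
    assume "9 * (of_nat n)^2 - 4 = (0 :: complex)"
    then have "(of_nat (9 * n^2) :: complex) = of_nat 4" by simp
    then have "9 * n^2 = 4" by (simp only: of_nat_eq_iff)
    then show False by presburger
  qed
  then have "\<exists>t. cosh_sqrt (t^2 * (9 * (of_nat n)^2 - 4)) = c n \<and>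
                 t * sinhc_sqrt (t^2 * (9 * (of_nat n)^2 - 4)) = s n" for n
    using pell_parametrization[OF pell] by metis
  then obtain t where t: "cosh_sqrt ((t n)^2 * (9 * (of_nat n)^2 - 4)) = c n"
      "t n * sinhc_sqrt ((t n)^2 * (9 * (of_nat n)^2 - 4)) = s n" for n
    by metis
  obtain h where h: "h holomorphic_on UNIV" "\<And>n. h (of_nat n) = t n"
    using entire_interpolation_nat by blast
  define C where "C x = cosh_sqrt ((h x)^2 * (9 * x^2 - 4))" for x
  define S where "S x = h x * sinhc_sqrt ((h x)^2 * (9 * x^2 - 4))" for x
  have hol: "(\<lambda>x. (h x)^2 * (9 * x^2 - 4)) holomorphic_on UNIV"
    by (intro holomorphic_intros h)
  have C: "C holomorphic_on UNIV" and S: "S holomorphic_on UNIV"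
    unfolding C_def[abs_def] S_def[abs_def]
    using holomorphic_on_compose_gen[OF hol cosh_sqrt_holomorphic]
          holomorphic_on_compose_gen[OF hol sinhc_sqrt_holomorphic]
    by (auto simp: o_def intro!: holomorphic_intros h(1))
  have CS: "(C x)^2 - (9 * x^2 - 4) * (S x)^2 = 1" for x
    using cosh_sqrt_pell[of "(h x)^2 * (9 * x^2 - 4)"]
    by (simp add: C_def S_def power_mult_distrib mult_ac)
  have CS': "(C x)^2 - (9 * x^2 - 4) * (- S x)^2 = 1" for x
    using CS[of x] by simp
  define g where "g p = markov_shear (C (p$1)) (S (p$1)) p" for p
  define g' where "g' p = markov_shear (C (p$1)) (- S (p$1)) p" for p
  have "markov_biholo g g'"
    unfolding markov_biholo_def
  proof (intro conjI allI)
    show "markov_entire g"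
      unfolding g_def[abs_def] by (rule markov_entire_shear[OF C S CS])
    show "markov_entire g'"
      unfolding g'_def[abs_def] by (rule markov_entire_shear[OF C holomorphic_on_minus[OF S] CS'])
    fix p
    have "g p $ 1 = p $ 1" "g' p $ 1 = p $ 1"
      by (simp_all add: g_def g'_def markov_shear_def)
    then show "g' (g p) = p" "g (g' p) = p"
      using markov_shear_inverse[OF CS, of p] markov_shear_inverse[OF CS', of p]
      by (simp_all add: g_def g'_def)
  qed
  moreover have "g p = markov_shear (c n) (s n) p" if "p$1 = of_nat n" for p n
    using that by (simp add: g_def C_def S_def h(2) t)
  ultimately show thesis using that by blast
qed

text \<open>In the (y, z)-plane, c p + s A p = q is a linear system for (c, s). Its determinant is
  -2 (y^2 + z^2 - 3xyz) at p, that is 2x^2 on the surface, and Cramer's rule gives the formulas for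
  c and s.\<close>

lemma markov_shear_transitive:
  assumes eq: "p$1 = q$1" and nz: "p$1 \<noteq> 0" and p: "markov_f p = 0" and q: "markov_f q = 0"
  obtains c s where "c^2 - (9 * (p$1)^2 - 4) * s^2 = 1" "markov_shear c s p = q"
proof -
  define x where "x = p$1"
  have x: "p$1 = x" "q$1 = x" "x \<noteq> 0" using eq nz by (simp_all add: x_def)
  define c where "c = (q$2 * (3 * x * p$3 - 2 * p$2) - q$3 * (2 * p$3 - 3 * x * p$2)) / (2 * x^2)"
  define s where "s = (p$2 * q$3 - p$3 * q$2) / (2 * x^2)"
  have fp: "(p$2)^2 + (p$3)^2 - 3 * x * p$2 * p$3 = - (x^2)"
    using p x by (simp add: markov_f_def algebra_simps eq_neg_iff_add_eq_0)
  have fq: "(q$2)^2 + (q$3)^2 - 3 * x * q$2 * q$3 = - (x^2)"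
    using q x by (simp add: markov_f_def algebra_simps eq_neg_iff_add_eq_0)
  have cs: "2 * x^2 * c = q$2 * (3 * x * p$3 - 2 * p$2) - q$3 * (2 * p$3 - 3 * x * p$2)"
           "2 * x^2 * s = p$2 * q$3 - p$3 * q$2"
    using x by (simp_all add: c_def s_def)
  have "2 * x^2 * (c * p$2 + s * (2 * p$3 - 3 * x * p$2)) = 2 * x^2 * q$2"
    using cs fp by algebra
  then have q2: "c * p$2 + s * (2 * p$3 - 3 * x * p$2) = q$2" using x by simp
  have "2 * x^2 * (c * p$3 - s * (2 * p$2 - 3 * x * p$3)) = 2 * x^2 * q$3"
    using cs fp by algebra
  then have q3: "c * p$3 - s * (2 * p$2 - 3 * x * p$3) = q$3" using x by simp
  \<comment> \<open>The quadratic form takes the value -x^2 at both points, so the factor by which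
    the shear scales it must be 1.\<close>
  have "(c^2 - (9 * x^2 - 4) * s^2) * x^2 = x^2"
    using fp fq q2 q3 by algebra
  then have "c^2 - (9 * x^2 - 4) * s^2 = 1" using x by simp
  moreover have "markov_shear c s p = q"
    using q2 q3 x by (simp add: markov_shear_def vec3_eq_iff)
  ultimately show thesis using that x by simp
qed

section \<open>The symplectic form\<close>

lemma markov_surface_iff: "p \<in> markov_surface \<longleftrightarrow> markov_f p = 0"
  by (simp add: markov_surface_def markov_f_def)

lemma markov_grad_nth [simp]:
  "markov_grad p $ 1 = 2 * p$1 - 3 * p$2 * p$3"
  "markov_grad p $ 2 = 2 * p$2 - 3 * p$1 * p$3"
  "markov_grad p $ 3 = 2 * p$3 - 3 * p$1 * p$2"
  by (simp_all add: markov_grad_def)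

lemma has_derivative_markov_f:
  "(markov_f has_derivative (\<lambda>u. \<Sum>i\<in>UNIV. markov_grad p $ i * u $ i)) (at p)"
  unfolding markov_f_def[abs_def] power2_eq_square
  by (rule has_derivative_eq_rhs,
      (rule has_derivative_nth has_derivative_add has_derivative_diff has_derivative_mult has_derivative_const)+)
     (simp add: fun_eq_iff sum_3 algebra_simps)

lemma markov_grad_derivative:
  assumes f: "\<And>p. markov_f (g p) = markov_f p" and L: "(g has_derivative L) (at p)"
  shows "(\<Sum>i\<in>UNIV. markov_grad (g p) $ i * L u $ i) = (\<Sum>i\<in>UNIV. markov_grad p $ i * u $ i)"
proof -
  have "markov_f \<circ> g = markov_f" using f by auto
  with diff_chain_at[OF L has_derivative_markov_f]
  have "(markov_f has_derivative (\<lambda>u. \<Sum>i\<in>UNIV. markov_grad (g p) $ i * u $ i) \<circ> L) (at p)"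
    by simp
  from has_derivative_unique[OF this has_derivative_markov_f]
  show ?thesis by (simp add: fun_eq_iff)
qed

text \<open>On tangent vectors, \<open>u \<times> v = \<omega>(u, v) grad f\<close>.\<close>
lemma det3_eq_markov_omega:
  assumes p: "markov_grad p \<noteq> 0" and u: "u \<in> markov_tangent p" and v: "v \<in> markov_tangent p"
  shows "det3 u v w = markov_omega p u v * (\<Sum>i\<in>UNIV. markov_grad p $ i * w $ i)"
proof -
  define a b c where abc: "a = markov_grad p $ 1" "b = markov_grad p $ 2" "c = markov_grad p $ 3"
  have om: "markov_omega p u v = (if c \<noteq> 0 then (u$1 * v$2 - u$2 * v$1) / c
      else if a \<noteq> 0 then (u$2 * v$3 - u$3 * v$2) / a else (u$3 * v$1 - u$1 * v$3) / b)"
    by (simp add: abc markov_omega_def)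
  have nz: "a \<noteq> 0 \<or> b \<noteq> 0 \<or> c \<noteq> 0"
    using p by (auto simp only: abc vec3_eq_iff zero_index)
  have u0: "a * u$1 + b * u$2 + c * u$3 = 0" and v0: "a * v$1 + b * v$2 + c * v$3 = 0"
    using u v unfolding markov_tangent_def mem_Collect_eq sum_3 abc by auto
  define m where "m = markov_omega p u v"
  \<comment> \<open>Tangency makes the cross product of u and v parallel to the gradient. Each
    branch of \<open>markov_omega\<close> reads the factor off one coordinate; the other two
    coordinates follow from \<open>u0\<close> and \<open>v0\<close>.\<close>
  have m: "m * a = u$2 * v$3 - u$3 * v$2 \<and> m * b = u$3 * v$1 - u$1 * v$3 \<and> m * c = u$1 * v$2 - u$2 * v$1"
  proof (cases "c = 0")
    case False
    then have mc: "m * c = u$1 * v$2 - u$2 * v$1" by (simp add: m_def om)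
    have "c * (m * a) = c * (u$2 * v$3 - u$3 * v$2)" "c * (m * b) = c * (u$3 * v$1 - u$1 * v$3)"
      using mc u0 v0 by algebra+
    with mc False show ?thesis by simp
  next
    case c: True
    show ?thesis
    proof (cases "a = 0")
      case False
      then have ma: "m * a = u$2 * v$3 - u$3 * v$2" by (simp add: m_def om c)
      have "a * (m * b) = a * (u$3 * v$1 - u$1 * v$3)" "a * (m * c) = a * (u$1 * v$2 - u$2 * v$1)"
        using ma u0 v0 by algebra+
      with ma False show ?thesis by simp
    next
      case True
      with nz c have "b \<noteq> 0" by simp
      then have mb: "m * b = u$3 * v$1 - u$1 * v$3" by (simp add: m_def om c True)
      have "b * (m * a) = b * (u$2 * v$3 - u$3 * v$2)" "b * (m * c) = b * (u$1 * v$2 - u$2 * v$1)"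
        using mb u0 v0 by algebra+
      with mb \<open>b \<noteq> 0\<close> show ?thesis by simp
    qed
  qed
  have "det3 u v w = m * (a * w$1 + b * w$2 + c * w$3)"
    unfolding det3_def using m by algebra
  then show ?thesis by (simp add: m_def abc sum_3)
qed

text \<open>Pair the cross product of the tangent vectors with a w on which df does not vanish: the
  triple product and df(w) are both preserved, hence so is their quotient \<omega>(u, v).\<close>

lemma markov_omega_preserved:
  assumes f: "\<And>p. markov_f (g p) = markov_f p" and L: "(g has_derivative L) (at p)"
    and det: "\<And>u v w. det3 (L u) (L v) (L w) = det3 u v w"
    and p: "markov_grad p \<noteq> 0" and u: "u \<in> markov_tangent p" and v: "v \<in> markov_tangent p"
  shows "markov_omega (g p) (L u) (L v) = markov_omega p u v"
proof -
  note grad = markov_grad_derivative[OF f L]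
  obtain i where i: "markov_grad p $ i \<noteq> 0"
    using p by (auto simp: vec_eq_iff)
  define w :: "complex^3" where "w = axis i 1"
  have w: "(\<Sum>i\<in>UNIV. markov_grad p $ i * w $ i) \<noteq> 0"
    using i by (simp add: w_def axis_def if_distrib cong: if_cong)
  with grad[of w] have "markov_grad (g p) \<noteq> 0" by auto
  moreover have "L u \<in> markov_tangent (g p)" "L v \<in> markov_tangent (g p)"
    using u v grad by (simp_all add: markov_tangent_def)
  ultimately have "det3 (L u) (L v) (L w) =
      markov_omega (g p) (L u) (L v) * (\<Sum>i\<in>UNIV. markov_grad p $ i * w $ i)"
    by (simp add: det3_eq_markov_omega grad)
  with det3_eq_markov_omega[OF p u v, of w] w show ?thesis by (simp add: det)
qed

text \<open>The orbit of p under the flow of x: at time 0 the coefficients are c = 1, s = 0 with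
  derivatives 0 and 1, so the initial velocity is A applied to (y, z).\<close>

lemma markov_curve:
  assumes p: "p \<in> markov_surface"
  obtains \<gamma> :: "real \<Rightarrow> complex^3" where "\<gamma> 0 = p" "\<And>t. \<gamma> t \<in> markov_surface"
    "(\<gamma> has_vector_derivative mk3 0 (markov_grad p $ 3) (- markov_grad p $ 2)) (at 0)"
proof -
  define d where "d = 9 * (p$1)^2 - 4"
  define C where "C z = cosh_sqrt (z^2 * d)" for z
  define S where "S z = z * sinhc_sqrt (z^2 * d)" for z
  define \<gamma> :: "real \<Rightarrow> complex^3" where "\<gamma> t = markov_shear (C (of_real t)) (S (of_real t)) p" for t
  have CS: "(C z)^2 - (9 * (p$1)^2 - 4) * (S z)^2 = 1" for z
    using cosh_sqrt_pell[of "z^2 * d"] by (simp add: C_def S_def d_def power_mult_distrib mult_ac)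
  obtain k where k: "(cosh_sqrt has_field_derivative k) (at 0)"
    using cosh_sqrt_holomorphic by (auto simp: holomorphic_on_def field_differentiable_def)
  obtain l where l: "(sinhc_sqrt has_field_derivative l) (at 0)"
    using sinhc_sqrt_holomorphic by (auto simp: holomorphic_on_def field_differentiable_def)
  have sq: "((\<lambda>z. z^2 * d) has_field_derivative 0) (at 0)"
    by (auto intro!: derivative_eq_intros)
  have "((\<lambda>z. cosh_sqrt (z^2 * d)) has_field_derivative k * 0) (at 0)"
    by (rule DERIV_chain2[OF _ sq]) (use k in simp)
  then have dC: "(C has_field_derivative 0) (at (of_real 0))"
    by (simp add: C_def[abs_def])
  have "((\<lambda>z. sinhc_sqrt (z^2 * d)) has_field_derivative l * 0) (at 0)"
    by (rule DERIV_chain2[OF _ sq]) (use l in simp)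
  from DERIV_mult[OF DERIV_ident this]
  have dS: "(S has_field_derivative 1) (at (of_real 0))"
    by (simp add: S_def[abs_def] sinhc_sqrt_0)
  have dC': "((\<lambda>t. C (of_real t)) has_derivative (\<lambda>t. t *\<^sub>R 0)) (at 0)"
    using has_vector_derivative_real_field[OF dC] by (simp add: has_vector_derivative_def)
  have dS': "((\<lambda>t. S (of_real t)) has_derivative (\<lambda>t. t *\<^sub>R 1)) (at 0)"
    using has_vector_derivative_real_field[OF dS] by (simp add: has_vector_derivative_def)
  have "(\<gamma> has_derivative (\<lambda>t. t *\<^sub>R mk3 0 (markov_grad p $ 3) (- markov_grad p $ 2))) (at 0)"
    unfolding \<gamma>_def[abs_def] markov_shear_def
    by (rule has_derivative_eq_rhs,
        (rule has_derivative_mk3 dC' dS' has_derivative_add has_derivative_diff has_derivative_mult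
           has_derivative_const)+)
       (auto simp: fun_eq_iff vec3_eq_iff scaleR_conv_of_real[where 'a = complex] algebra_simps)
  moreover have "\<gamma> 0 = p"
    by (simp add: \<gamma>_def C_def S_def markov_shear_def cosh_sqrt_0 vec3_eq_iff)
  moreover have "\<gamma> t \<in> markov_surface" for t
    using p markov_f_shear[OF CS] by (simp add: \<gamma>_def markov_surface_iff)
  ultimately show thesis using that by (simp add: has_vector_derivative_def)
qed

lemma derivative_zero_along_curve:
  fixes \<gamma> :: "real \<Rightarrow> complex^3" and d :: "complex^3 \<Rightarrow> complex^3"
  assumes U: "open U" "p \<in> U" and d: "\<And>q. q \<in> M \<inter> U \<Longrightarrow> d q = 0" and K: "(d has_derivative K) (at p)"
    and \<gamma>: "\<gamma> 0 = p" "\<And>t. \<gamma> t \<in> M" "(\<gamma> has_vector_derivative V) (at 0)"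
  shows "K V = 0"
proof -
  have "(d \<circ> \<gamma> has_vector_derivative K V) (at 0)"
    using K \<gamma> by (intro vector_derivative_diff_chain_within) (auto intro: has_derivative_at_withinI)
  moreover have "(d \<circ> \<gamma> has_vector_derivative 0) (at 0)"
  proof -
    have "isCont \<gamma> 0" by (rule has_vector_derivative_continuous[OF \<gamma>(3)])
    then have "\<forall>\<^sub>F t in nhds 0. \<gamma> t \<in> U"
      using U \<gamma>(1) by (auto simp: isCont_def tendsto_at_iff_tendsto_nhds dest: topological_tendstoD)
    then have "\<forall>\<^sub>F t in nhds 0. (d \<circ> \<gamma>) t = 0"
      by eventually_elim (use d \<gamma>(2) in auto)
    then obtain S where "open S" "0 \<in> S" "\<And>t. t \<in> S \<Longrightarrow> 0 = (d \<circ> \<gamma>) t"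
      by (auto simp: eventually_nhds)
    then show ?thesis
      by (rule has_vector_derivative_transform_within_open[OF has_vector_derivative_const])
  qed
  ultimately show ?thesis by (rule vector_derivative_unique_at)
qed

lemma markov_rot_vector_derivative:
  "(\<gamma> has_vector_derivative V) F \<Longrightarrow> ((\<lambda>t. markov_rot (\<gamma> t)) has_vector_derivative markov_rot V) F"
  by (rule bounded_linear.has_vector_derivative)
     (auto intro!: linear_conv_bounded_linear[THEN iffD1] linearI simp: markov_rot_def vec3_eq_iff)

lemma markov_rot_surface: "markov_rot p \<in> markov_surface \<longleftrightarrow> p \<in> markov_surface"
  using markov_entire_rot by (simp add: markov_entire_def markov_surface_iff)

text \<open>The velocities of the three Hamiltonian flows span the tangent space, so no implicit function
  theorem is needed to see that an extension of a map off \<open>M\<close> determines its derivative along \<open>M\<close>.\<close>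
lemma derivative_zero_on_tangent:
  fixes d :: "complex^3 \<Rightarrow> complex^3"
  assumes p: "p \<in> markov_reg" and U: "open U" "p \<in> U"
    and d: "\<And>q. q \<in> markov_surface \<inter> U \<Longrightarrow> d q = 0" and K: "(d has_derivative K) (at p)"
    and hom: "\<And>c u. K (c *s u) = c *s K u" and u: "u \<in> markov_tangent p"
  shows "K u = 0"
proof -
  have zero: "K V = 0" if "\<gamma> 0 = p" "\<And>t. \<gamma> t \<in> markov_surface" "(\<gamma> has_vector_derivative V) (at 0)" for \<gamma> V
    using derivative_zero_along_curve[OF U d K that] by simp
  have pM: "p \<in> markov_surface" and nz: "markov_grad p \<noteq> 0"
    using p by (auto simp: markov_reg_def)
  define a b c where abc: "a = markov_grad p $ 1" "b = markov_grad p $ 2" "c = markov_grad p $ 3"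
  have nz: "a \<noteq> 0 \<or> b \<noteq> 0 \<or> c \<noteq> 0"
    using nz by (auto simp only: abc vec3_eq_iff zero_index)
  have u0: "a * u$1 + b * u$2 + c * u$3 = 0"
    using u unfolding markov_tangent_def mem_Collect_eq sum_3 abc by auto
  have rot3: "markov_rot (markov_rot (markov_rot q)) = q" for q
    by (simp add: markov_rot_def vec3_eq_iff)
  have K1: "K (mk3 0 c (- b)) = 0"
    using markov_curve[OF pM] zero unfolding abc by metis
  \<comment> \<open>The flow of y at p is the flow of x at the rotated point, brought back by two
    further rotations. The flow of z is treated likewise in \<open>K3\<close>.\<close>
  have K2: "K (mk3 (- c) 0 a) = 0"
  proof -
    obtain \<gamma> where \<gamma>: "\<gamma> 0 = markov_rot p" "\<And>t. \<gamma> t \<in> markov_surface"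
      "(\<gamma> has_vector_derivative mk3 0 (markov_grad (markov_rot p) $ 3) (- markov_grad (markov_rot p) $ 2)) (at 0)"
      using markov_curve[of "markov_rot p"] pM markov_rot_surface by metis
    have "K (markov_rot (markov_rot (mk3 0 (markov_grad (markov_rot p) $ 3) (- markov_grad (markov_rot p) $ 2)))) = 0"
      by (rule zero[OF _ _ markov_rot_vector_derivative[OF markov_rot_vector_derivative[OF \<gamma>(3)]]])
         (auto simp: \<gamma> rot3 markov_rot_surface)
    then show ?thesis by (simp add: abc markov_rot_def mult_ac)
  qed
  have K3: "K (mk3 b (- a) 0) = 0"
  proof -
    let ?q = "markov_rot (markov_rot p)"
    obtain \<gamma> where \<gamma>: "\<gamma> 0 = ?q" "\<And>t. \<gamma> t \<in> markov_surface"
      "(\<gamma> has_vector_derivative mk3 0 (markov_grad ?q $ 3) (- markov_grad ?q $ 2)) (at 0)"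
      using markov_curve[of ?q] pM markov_rot_surface by metis
    have "K (markov_rot (mk3 0 (markov_grad ?q $ 3) (- markov_grad ?q $ 2))) = 0"
      by (rule zero[OF _ _ markov_rot_vector_derivative[OF \<gamma>(3)]])
         (auto simp: \<gamma> rot3 markov_rot_surface)
    then show ?thesis by (simp add: abc markov_rot_def mult_ac)
  qed
  have lin: "K (k *s v + l *s w) = 0" if "K v = 0" "K w = 0" for k l v w
    using that has_derivative_linear[OF K] by (simp add: linear_add hom)
  \<comment> \<open>Where a gradient component is nonzero, two of the three velocities span the
    tangent space: the coefficients match two coordinates of u, and tangency gives the
    third.\<close>
  consider "c \<noteq> 0" | "a \<noteq> 0" | "b \<noteq> 0" using nz by blast
  then show ?thesis
  proof cases
    case 1
    have "u = (u$2 / c) *s mk3 0 c (- b) + (- u$1 / c) *s mk3 (- c) 0 a"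
      using 1 u0 by (simp add: vec3_eq_iff field_simps) algebra
    then show ?thesis using lin[OF K1 K2] by metis
  next
    case 2
    have "u = (u$3 / a) *s mk3 (- c) 0 a + (- u$2 / a) *s mk3 b (- a) 0"
      using 2 u0 by (simp add: vec3_eq_iff field_simps) algebra
    then show ?thesis using lin[OF K2 K3] by metis
  next
    case 3
    have "u = (u$1 / b) *s mk3 b (- a) 0 + (- u$3 / b) *s mk3 0 c (- b)"
      using 3 u0 by (simp add: vec3_eq_iff field_simps) algebra
    then show ?thesis using lin[OF K3 K1] by metis
  qed
qed

section \<open>From automorphisms of complex 3-space to the group G\<close>

lemma markov_entire_symplectic:
  assumes "markov_entire F"
  shows "markov_symplectic F"
  unfolding markov_symplectic_def
proof (intro ballI allI impI; elim conjE)
  fix p U g L u v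
  assume p: "p \<in> markov_reg" and U: "open U" "p \<in> U" and g: "holo3 g U"
    and eq: "\<forall>q\<in>markov_surface \<inter> U. g q = F q" and L: "(g has_derivative L) (at p)"
    and u: "u \<in> markov_tangent p" and v: "v \<in> markov_tangent p"
  obtain K where K: "(F has_derivative K) (at p)" "\<And>c u. K (c *s u) = c *s K u"
      "\<And>u v w. det3 (K u) (K v) (K w) = det3 u v w"
    using assms unfolding markov_entire_def by metis
  \<comment> \<open>By uniqueness of derivatives, \<open>L\<close> is the complex-linear map that
    \<open>holo3\<close> provides.\<close>
  have hom: "L (c *s u) = c *s L u" for c u
    using g U(2) L has_derivative_unique unfolding holo3_def by metis
  \<comment> \<open>The local extension \<open>g\<close> is arbitrary, but g - F vanishes on the
    surface near p, so both derivatives agree on tangent vectors.\<close>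
  have "L w = K w" if "w \<in> markov_tangent p" for w
    using derivative_zero_on_tangent[OF p U _ has_derivative_diff[OF L K(1)] _ that] eq
    by (simp add: hom K(2) vector_ssub_ldistrib)
  then show "markov_omega (F p) (L u) (L v) = markov_omega p u v"
    using markov_omega_preserved[OF _ K(1,3) _ u v] u v p assms
    by (simp add: markov_reg_def markov_entire_def)
qed

lemma markov_entire_holo_map:
  assumes "markov_entire g" "\<And>q. q \<in> markov_surface \<Longrightarrow> F q = g q"
  shows "holo_map_on markov_surface F"
  unfolding holo_map_on_def
proof (intro conjI ballI)
  show "F ` markov_surface \<subseteq> markov_surface"
    using assms by (auto simp: markov_entire_def markov_surface_iff)
  show "\<exists>U g. open U \<and> p \<in> U \<and> holo3 g U \<and> (\<forall>q\<in>markov_surface \<inter> U. g q = F q)" for p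
  proof (intro exI conjI)
    show "holo3 g UNIV"
      using assms(1) by (auto simp: markov_entire_def holo3_def)
  qed (use assms(2) in auto)
qed

lemma markov_biholo_in_G:
  assumes "markov_biholo F F'"
  shows "F \<in> markov_G"
proof -
  have F: "markov_entire F" "markov_entire F'" and inv: "F' (F p) = p" "F (F' p) = p" for p
    using assms by (auto simp: markov_biholo_def)
  have surf: "F p \<in> markov_surface \<longleftrightarrow> p \<in> markov_surface" "F' p \<in> markov_surface \<longleftrightarrow> p \<in> markov_surface" for p
    using F by (auto simp: markov_entire_def markov_surface_iff)
  have bij: "bij_betw F markov_surface markov_surface"
    by (rule bij_betwI[of _ _ _ F']) (auto simp: surf inv)
  \<comment> \<open>\<open>inv_into\<close> is controlled only on the surface, which is where
    \<open>holo_map_on\<close> looks at it.\<close>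
  have "inv_into markov_surface F q = F' q" if "q \<in> markov_surface" for q
    using bij that by (intro inv_into_f_eq) (auto simp: bij_betw_def surf inv)
  then show ?thesis
    using F bij markov_entire_symplectic markov_entire_holo_map
    by (simp add: markov_G_def holo_aut_def)
qed

section \<open>Ordered Markov triples\<close>

text \<open>Terms n and n + 1 form the n-th iterate of the Vieta map at (x, y). Integers are used
  because differences of two triples, of either sign, also serve as initial values.\<close>

fun vieta_seq :: "int \<Rightarrow> int \<Rightarrow> int \<Rightarrow> nat \<Rightarrow> int" where
  "vieta_seq z x y 0 = x"
| "vieta_seq z x y (Suc 0) = y"
| "vieta_seq z x y (Suc (Suc n)) = 3 * z * vieta_seq z x y (Suc n) - vieta_seq z x y n"

lemma vieta_seq_diff:
  "vieta_seq z x y n - vieta_seq z x' y' n = vieta_seq z (x - x') (y - y') n"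
  by (induction z x y n rule: vieta_seq.induct) (simp_all add: algebra_simps)

text \<open>As z is at least 1, the next term is at least 3v - u for consecutive terms u, v with u
  at most v and v positive. A negative first term is allowed, for use with differences.\<close>

lemma vieta_seq_mono:
  assumes "1 \<le> z" "0 < y" "x \<le> y"
  shows "vieta_seq z x y n \<le> vieta_seq z x y (Suc n) \<and> 0 < vieta_seq z x y (Suc n)"
proof (induction n)
  case 0
  then show ?case using assms by simp
next
  case (Suc n)
  have "3 * vieta_seq z x y (Suc n) \<le> 3 * z * vieta_seq z x y (Suc n)"
    using Suc assms(1) by simp
  then show ?case using Suc unfolding vieta_seq.simps by linarith
qed

lemma vieta_seq_ge:
  assumes "1 \<le> z" "1 \<le> x" "x \<le> y"
  shows "int n \<le> vieta_seq z x y n \<and> int (Suc n) \<le> vieta_seq z x y (Suc n)"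
proof (induction n)
  case 0
  then show ?case using assms by simp
next
  case (Suc n)
  have "3 * vieta_seq z x y (Suc n) \<le> 3 * z * vieta_seq z x y (Suc n)"
    using Suc assms(1) by simp
  moreover have "vieta_seq z x y n \<le> vieta_seq z x y (Suc n)"
    using vieta_seq_mono[of z y x n] assms by simp
  ultimately show ?case using Suc unfolding vieta_seq.simps by linarith
qed

lemma vieta_seq_le:
  assumes "1 \<le> z" "1 \<le> x" "x \<le> y" "y \<le> z"
  shows "vieta_seq z x y n \<le> (3 * z) ^ n * z \<and> vieta_seq z x y (Suc n) \<le> (3 * z) ^ Suc n * z"
proof (induction n)
  case 0
  have "1 * z \<le> (3 * z) * z" using assms(1) by (intro mult_right_mono) auto
  then have "y \<le> 3 * z * z" using assms(4) by linarith
  then show ?case using assms by simp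
next
  case (Suc n)
  have "3 * z * vieta_seq z x y (Suc n) \<le> 3 * z * ((3 * z) ^ Suc n * z)"
    using Suc assms by (intro mult_left_mono) auto
  moreover have "0 \<le> vieta_seq z x y n"
    using vieta_seq_ge[of z x y n] assms by linarith
  ultimately have "vieta_seq z x y (Suc (Suc n)) \<le> 3 * z * ((3 * z) ^ Suc n * z)"
    unfolding vieta_seq.simps by linarith
  with Suc show ?case by (simp only: power_Suc[of _ "Suc n"] mult.assoc)
qed

lemma vieta_seq_nonzero:
  assumes "1 \<le> z" "x < 0" "0 < y"
  shows "vieta_seq z x y n \<noteq> 0"
  using vieta_seq_mono[of z y x "n - 1"] assms by (cases n) auto

text \<open>The coefficients depend on z and n alone, so one shear iterates the Vieta map on all
  triples of a fibre at once.\<close>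

lemma vieta_seq_shear:
  fixes z :: int
  obtains c s :: complex where "c^2 - (9 * (of_int z)^2 - 4) * s^2 = 1"
    "\<And>x y. of_int (vieta_seq z x y n) = c * of_int x + s * (2 * of_int y - 3 * of_int z * of_int x)"
    "\<And>x y. of_int (vieta_seq z x y (Suc n)) = c * of_int y - s * (2 * of_int x - 3 * of_int z * of_int y)"
proof -
  have "\<exists>c s :: complex. c^2 - (9 * (of_int z)^2 - 4) * s^2 = 1 \<and>
    (\<forall>x y. of_int (vieta_seq z x y n) = c * of_int x + s * (2 * of_int y - 3 * of_int z * of_int x) \<and>
           of_int (vieta_seq z x y (Suc n)) = c * of_int y - s * (2 * of_int x - 3 * of_int z * of_int y))"
  proof (induction n)
    case 0
    show ?case by (intro exI[of _ 1] exI[of _ 0]) simp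
  next
    case (Suc n)
    then obtain c s :: complex where cs: "c^2 - (9 * (of_int z)^2 - 4) * s^2 = 1"
      "\<And>x y. of_int (vieta_seq z x y n) = c * of_int x + s * (2 * of_int y - 3 * of_int z * of_int x)"
      "\<And>x y. of_int (vieta_seq z x y (Suc n)) = c * of_int y - s * (2 * of_int x - 3 * of_int z * of_int y)"
      by blast
    \<comment> \<open>One step \<open>(x, y) \<mapsto> (y, 3zy - x)\<close> is the shear with parameters \<open>(3z/2, 1/2)\<close>.\<close>
    define c' where "c' = (3 * of_int z * c + (9 * (of_int z)^2 - 4) * s) / 2"
    define s' where "s' = (c + 3 * of_int z * s) / 2"
    have "c'^2 - (9 * (of_int z)^2 - 4) * s'^2 = c^2 - (9 * (of_int z)^2 - 4) * s^2"
      by (simp add: c'_def s'_def field_simps power2_eq_square)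
    with cs(1) have "c'^2 - (9 * (of_int z)^2 - 4) * s'^2 = 1" by simp
    moreover have "of_int (vieta_seq z x y (Suc n)) = c' * of_int x + s' * (2 * of_int y - 3 * of_int z * of_int x)" for x y
      unfolding cs(3) by (simp add: c'_def s'_def field_simps power2_eq_square)
    moreover have "of_int (vieta_seq z x y (Suc (Suc n))) = c' * of_int y - s' * (2 * of_int x - 3 * of_int z * of_int y)" for x y
      by (simp add: cs(2,3) c'_def s'_def field_simps power2_eq_square)
    ultimately show ?case by blast
  qed
  then show thesis using that by blast
qed

section \<open>Separating the triples by large Vieta iterates\<close>

definition nat_triples :: "(nat \<times> nat \<times> nat) set" where
  "nat_triples = {(x, y, z). 1 \<le> x \<and> x \<le> y \<and> y \<le> z \<and> x^2 + y^2 + z^2 = 3 * x * y * z}"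

text \<open>Subtracting the equations gives a vanishing combination of x' - x and y' - y with
  positive coefficients. Hence distinct triples over the same z must have x and y changing in
  opposite directions.\<close>

lemma markov_triples_opposite:
  fixes x x' y y' z :: int
  assumes "x^2 + y^2 + z^2 = 3 * x * y * z" "x'^2 + y'^2 + z^2 = 3 * x' * y' * z"
    and "1 \<le> x" "y \<le> z" "y' \<le> z" "x' \<le> y'" and le: "x \<le> x'" "y \<le> y'" and z: "1 \<le> z" "1 \<le> y'"
  shows "x = x' \<and> y = y'"
proof -
  have eq: "(x' - x) * (3 * y' * z - x - x') + (y' - y) * (3 * x * z - y - y') = 0"
    using assms(1,2) by (simp add: algebra_simps power2_eq_square)
  have "3 * y' \<le> 3 * y' * z" "3 * z \<le> 3 * x * z"
    using assms by (simp_all add: mult_le_cancel_left1 mult_le_cancel_right1)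
  then have pos: "0 < 3 * y' * z - x - x'" "0 < 3 * x * z - y - y'"
    using assms by linarith+
  then have "0 \<le> (x' - x) * (3 * y' * z - x - x')" "0 \<le> (y' - y) * (3 * x * z - y - y')"
    using le by simp_all
  with eq have "(x' - x) * (3 * y' * z - x - x') = 0" "(y' - y) * (3 * x * z - y - y') = 0"
    by linarith+
  with pos show ?thesis by auto
qed

text \<open>Grows so fast that the values of \<open>spread\<close> below on different fibres over \<open>z\<close> lie in disjoint ranges;
  this sidesteps the open question whether \<open>z\<close> determines the triple.\<close>
primrec iter_count :: "nat \<Rightarrow> nat" where
  "iter_count 0 = 0"
| "iter_count (Suc z) = iter_count z + (3 * z) ^ Suc (iter_count z) * z + 1"

lemma iter_count_gt:
  assumes "z < z'"
  shows "(3 * z) ^ Suc (iter_count z) * z < iter_count z'"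
proof -
  have "mono iter_count"
    by (intro incseq_SucI) simp
  then have "iter_count (Suc z) \<le> iter_count z'"
    by (rule monoD) (use assms in simp)
  then show ?thesis by simp
qed

text \<open>For k = 0 and k = 1 these are the first two coordinates of a triple after the initial
  flow of z.\<close>

definition spread :: "nat \<Rightarrow> nat \<times> nat \<times> nat \<Rightarrow> nat" where
  "spread k = (\<lambda>(x, y, z). nat (vieta_seq (int z) (int x) (int y) (iter_count z + k)))"

lemma of_nat_spread:
  assumes "(x, y, z) \<in> nat_triples"
  shows "int (spread k (x, y, z)) = vieta_seq (int z) (int x) (int y) (iter_count z + k)"
    and "iter_count z + k \<le> spread k (x, y, z)"
  using vieta_seq_ge[of "int z" "int x" "int y" "iter_count z + k"] assms
  by (auto simp: spread_def nat_triples_def)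

lemma spread_pos:
  assumes "a \<in> nat_triples"
  shows "0 < spread k a"
proof -
  obtain x y z where a: "a = (x, y, z)" by (cases a)
  have xyz: "1 \<le> x" "x \<le> y" "y \<le> z" using assms by (auto simp: a nat_triples_def)
  have "0 < iter_count z" using xyz by (cases z) auto
  with of_nat_spread(2)[of x y z k] assms show ?thesis by (simp add: a)
qed

text \<open>The upper bound of \<open>vieta_seq_le\<close> on the fibre z is below
  \<open>iter_count z'\<close>, which bounds the values on the fibre z' from below.\<close>

lemma spread_less:
  assumes a: "(x, y, z) \<in> nat_triples" and a': "(x', y', z') \<in> nat_triples" and "z < z'" and "k \<le> 1"
  shows "spread k (x, y, z) < spread k (x', y', z')"
proof -
  have xyz: "1 \<le> x" "x \<le> y" "y \<le> z" using a by (auto simp: nat_triples_def)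
  have "int (spread k (x, y, z)) \<le> (3 * int z) ^ (iter_count z + k) * int z"
    using vieta_seq_le[of "int z" "int x" "int y" "iter_count z + k"] xyz
    by (simp add: of_nat_spread[OF a])
  \<comment> \<open>The exponent \<open>Suc (iter_count z)\<close> built into
    \<open>iter_count\<close> leaves room for exactly k = 0 and k = 1.\<close>
  also have "\<dots> \<le> (3 * int z) ^ Suc (iter_count z) * int z"
    using xyz \<open>k \<le> 1\<close> by (intro mult_right_mono power_increasing) auto
  also have "\<dots> = int ((3 * z) ^ Suc (iter_count z) * z)" by simp
  also have "\<dots> < int (iter_count z')"
    using iter_count_gt[OF \<open>z < z'\<close>] by (simp only: of_nat_less_iff)
  finally show ?thesis using of_nat_spread(2)[OF a', of k] by simp
qed

text \<open>Different z are excluded by \<open>spread_less\<close>. Over one z the sequence is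
  linear in its initial values, so the differences generate a sequence with a zero. Differences of
  opposite sign contradict \<open>vieta_seq_nonzero\<close>; otherwise
  \<open>markov_triples_opposite\<close> forces equality.\<close>

lemma inj_on_spread:
  assumes "k \<le> 1"
  shows "inj_on (spread k) nat_triples"
proof (rule inj_onI)
  fix a b
  assume ab: "a \<in> nat_triples" "b \<in> nat_triples" and eq: "spread k a = spread k b"
  obtain x y z x' y' z' where [simp]: "a = (x, y, z)" "b = (x', y', z')"
    by (cases a; cases b)
  have zz: "z' = z"
    using spread_less[of x y z x' y' z' k] spread_less[of x' y' z' x y z k] ab eq assms
    by (auto intro: linorder_cases[of z z'])
  let ?m = "iter_count z + k"
  have "vieta_seq z x y ?m = vieta_seq z x' y' ?m"
    using of_nat_spread(1)[of x y z k] of_nat_spread(1)[of x' y' z k] ab eq zz by simp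
  then have d: "vieta_seq z (int x - int x') (int y - int y') ?m = 0"
    "vieta_seq z (int x' - int x) (int y' - int y) ?m = 0"
    using vieta_seq_diff[of z x y ?m x' y'] vieta_seq_diff[of z x' y' ?m x y] by simp_all
  have t: "1 \<le> int x" "int x \<le> int y" "int y \<le> int z" "1 \<le> int x'" "int x' \<le> int y'" "int y' \<le> int z"
    using ab zz by (auto simp: nat_triples_def)
  have e: "(int x)^2 + (int y)^2 + (int z)^2 = 3 * int x * int y * int z"
    "(int x')^2 + (int y')^2 + (int z)^2 = 3 * int x' * int y' * int z"
    using ab zz unfolding nat_triples_def
    by (auto dest!: arg_cong[where f = int and x = "_ + _"])
  have 1: "\<not> (int x < int x' \<and> int y' < int y)" "\<not> (int x' < int x \<and> int y < int y')"
    using vieta_seq_nonzero[of z "int x - int x'" "int y - int y'" ?m]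
      vieta_seq_nonzero[of z "int x' - int x" "int y' - int y" ?m] d t by auto
  then have "int x \<le> int x' \<and> int y \<le> int y' \<or> int x' \<le> int x \<and> int y' \<le> int y"
    by linarith
  then have "int x = int x' \<and> int y = int y'"
    using markov_triples_opposite[OF e(1,2)] markov_triples_opposite[OF e(2,1)] t by auto
  then show "a = b" using zz by simp
qed

section \<open>The triples as an infinite, uniformly separated subset of the regular part\<close>

definition triple_point :: "nat \<times> nat \<times> nat \<Rightarrow> complex^3" where
  "triple_point = (\<lambda>(x, y, z). mk3 (of_nat x) (of_nat y) (of_nat z))"

lemma ordered_markov_triples_eq: "ordered_markov_triples = triple_point ` nat_triples"
proof
  show "ordered_markov_triples \<subseteq> triple_point ` nat_triples"
  proof
    fix p
    assume "p \<in> ordered_markov_triples"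
    then obtain x y z :: nat where "p = mk3 (of_nat x) (of_nat y) (of_nat z)"
        "1 \<le> x" "x \<le> y" "y \<le> z" "x^2 + y^2 + z^2 = 3 * x * y * z"
      unfolding ordered_markov_triples_def by blast
    then have "p = triple_point (x, y, z)" "(x, y, z) \<in> nat_triples"
      by (simp_all add: triple_point_def nat_triples_def)
    then show "p \<in> triple_point ` nat_triples" by blast
  qed
  show "triple_point ` nat_triples \<subseteq> ordered_markov_triples"
  proof (rule image_subsetI)
    fix a
    assume "a \<in> nat_triples"
    moreover obtain x y z where a: "a = (x, y, z)" by (cases a)
    ultimately have "1 \<le> x" "x \<le> y" "y \<le> z" "x^2 + y^2 + z^2 = 3 * x * y * z"
      by (simp_all add: nat_triples_def)
    moreover from this have "1 \<le> y" "1 \<le> z" by linarith+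
    ultimately show "triple_point a \<in> ordered_markov_triples"
      unfolding ordered_markov_triples_def triple_point_def a prod.case by blast
  qed
qed

lemma inj_triple_point: "inj triple_point"
  by (auto simp: inj_def triple_point_def vec3_eq_iff)

lemma triple_point_surface:
  assumes "a \<in> nat_triples"
  shows "markov_f (triple_point a) = 0"
proof -
  obtain x y z where a: "a = (x, y, z)" by (cases a)
  with assms have "x^2 + y^2 + z^2 = 3 * x * y * z"
    by (simp add: nat_triples_def)
  then have "(of_nat (x^2 + y^2 + z^2) :: complex) = of_nat (3 * x * y * z)"
    by (rule arg_cong)
  then show ?thesis by (simp add: a triple_point_def markov_f_def)
qed

lemma infinite_nat_triples: "infinite nat_triples"
proof
  \<comment> \<open>The sequence 1, 1, 2, 5, 13, ... of odd-indexed Fibonacci numbers yields the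
    triples (1, X n, X (n + 1)).\<close>
  define X where "X = vieta_seq 1 1 1"
  have "1 \<le> X n \<and> X n \<le> X (Suc n) \<and> 1 + (X n)^2 + (X (Suc n))^2 = 3 * X n * X (Suc n)" for n
  proof (induction n)
    case 0
    show ?case by (simp add: X_def)
  next
    case (Suc n)
    then show ?case by (auto simp: X_def algebra_simps power2_eq_square)
  qed
  note X = this
  have mem: "(1, nat (X n), nat (X (Suc n))) \<in> nat_triples" for n
  proof -
    have "int (1^2 + (nat (X n))^2 + (nat (X (Suc n)))^2) = int (3 * 1 * nat (X n) * nat (X (Suc n)))"
      using X[of n] by simp
    then show ?thesis using X[of n] unfolding nat_triples_def by (simp only: of_nat_eq_iff) auto
  qed
  assume "finite nat_triples"
  then have "finite ((\<lambda>(x, y, z). z) ` nat_triples)" by simp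
  then obtain m where m: "\<And>x y z. (x, y, z) \<in> nat_triples \<Longrightarrow> z \<le> m"
    unfolding finite_nat_set_iff_bounded_le by fastforce
  have "int (Suc m) \<le> X (Suc m)"
    using vieta_seq_ge[of 1 1 1 m] by (simp add: X_def)
  with m[OF mem[of m]] show False by linarith
qed

lemma triple_point_dist:
  assumes "dist (triple_point a) (triple_point b) < 1"
  shows "a = b"
proof -
  obtain x y z x' y' z' where [simp]: "a = (x, y, z)" "b = (x', y', z')"
    by (cases a; cases b)
  have close: "m = n" if "norm (of_nat m - of_nat n :: complex) < 1" for m n :: nat
  proof -
    have "norm (of_int (int m - int n) :: complex) < 1" using that by simp
    then have "\<bar>int m - int n\<bar> < 1" unfolding norm_of_int by linarith
    then show ?thesis by simp
  qed
  have "norm ((triple_point a - triple_point b) $ i) < 1" for i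
    using assms Finite_Cartesian_Product.norm_nth_le[of "triple_point a - triple_point b" i] by (simp add: dist_norm)
  from this[of 1] this[of 2] this[of 3] show ?thesis
    by (simp add: triple_point_def close)
qed

text \<open>The partial derivative 2x - 3yz is negative, since 2x < 3y and z is at least 1.\<close>

lemma triple_point_regular:
  assumes "a \<in> nat_triples"
  shows "triple_point a \<in> markov_reg"
proof -
  obtain x y z where a: "a = (x, y, z)" by (cases a)
  have xyz: "1 \<le> x" "x \<le> y" "y \<le> z" using assms by (auto simp: a nat_triples_def)
  then have "3 * y * 1 \<le> 3 * y * z" by (intro mult_left_mono) auto
  then have "2 * x \<noteq> 3 * y * z" using xyz by linarith
  then have "(of_nat (2 * x) :: complex) \<noteq> of_nat (3 * y * z)" by (simp only: of_nat_eq_iff not_False_eq_True)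
  then have "markov_grad (triple_point a) $ 1 \<noteq> 0" by (simp add: a triple_point_def)
  then have "markov_grad (triple_point a) \<noteq> 0" by (metis zero_index)
  then show ?thesis
    using triple_point_surface[OF assms] by (auto simp: markov_reg_def markov_surface_iff)
qed

section \<open>Assembling the automorphism from flows of z, x and y\<close>

lemma exists_spreading_biholo:
  obtains g g' where "markov_biholo g g'"
    "\<And>x y z. (x, y, z) \<in> nat_triples \<Longrightarrow>
       g (triple_point (x, y, z)) = mk3 (of_nat (spread 0 (x, y, z))) (of_nat (spread 1 (x, y, z))) (of_nat z)"
proof -
  have "\<exists>c s :: complex. c^2 - (9 * (of_nat z)^2 - 4) * s^2 = 1 \<and>
    (\<forall>x y. of_int (vieta_seq z x y (iter_count z)) = c * of_int x + s * (2 * of_int y - 3 * of_nat z * of_int x) \<and>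
           of_int (vieta_seq z x y (Suc (iter_count z))) = c * of_int y - s * (2 * of_int x - 3 * of_nat z * of_int y))" for z :: nat
    using vieta_seq_shear[of "int z" "iter_count z"] by (metis of_int_of_nat_eq)
  then obtain c s :: "nat \<Rightarrow> complex" where cs: "(c z)^2 - (9 * (of_nat z)^2 - 4) * (s z)^2 = 1"
    "of_int (vieta_seq z x y (iter_count z)) = c z * of_int x + s z * (2 * of_int y - 3 * of_nat z * of_int x)"
    "of_int (vieta_seq z x y (Suc (iter_count z))) = c z * of_int y - s z * (2 * of_int x - 3 * of_nat z * of_int y)" for z x y
    by metis
  obtain g g' where g: "markov_biholo g g'" "\<And>p n. p$1 = of_nat n \<Longrightarrow> g p = markov_shear (c n) (s n) p"
    using markov_shear_interpolation[of c s] cs(1) by blast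
  have rot: "markov_biholo (markov_rot \<circ> markov_rot) markov_rot"
    by (rule markov_biholo_sym[OF markov_biholo_rot])
  \<comment> \<open>Two rotations turn (x, y, z) into (z, x, y), so the conjugated shear is a flow
    of z.\<close>
  have "(markov_rot \<circ> (g \<circ> (markov_rot \<circ> markov_rot))) (triple_point (x, y, z)) =
      mk3 (of_nat (spread 0 (x, y, z))) (of_nat (spread 1 (x, y, z))) (of_nat z)"
    if a: "(x, y, z) \<in> nat_triples" for x y z
  proof -
    have sp: "of_nat (spread k (x, y, z)) = (of_int (vieta_seq z x y (iter_count z + k)) :: complex)" for k
      using of_nat_spread(1)[OF a, of k] by (metis of_int_of_nat_eq)
    have "g (mk3 (of_nat z) (of_nat x) (of_nat y)) =
        mk3 (of_nat z) (of_nat (spread 0 (x, y, z))) (of_nat (spread 1 (x, y, z)))"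
      by (simp add: g(2)[of _ z] markov_shear_def vec3_eq_iff sp cs(2,3))
    then show ?thesis by (simp add: triple_point_def markov_rot_def)
  qed
  then show thesis
    using that[OF markov_biholo_comp[OF markov_biholo_rot markov_biholo_comp[OF g(1) rot]]] by blast
qed

text \<open>Injectivity of k leaves at most one point \<open>P i\<close> on each fibre, so the shear
  taking it to \<open>Q i\<close> can be chosen fibre by fibre and interpolated.\<close>

lemma exists_moving_biholo:
  fixes k :: "'a \<Rightarrow> nat" and P Q :: "'a \<Rightarrow> complex^3"
  assumes inj: "inj_on k I" and pos: "\<And>i. i \<in> I \<Longrightarrow> 0 < k i"
    and P: "\<And>i. i \<in> I \<Longrightarrow> P i $ 1 = of_nat (k i)" "\<And>i. i \<in> I \<Longrightarrow> markov_f (P i) = 0"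
    and Q: "\<And>i. i \<in> I \<Longrightarrow> Q i $ 1 = of_nat (k i)" "\<And>i. i \<in> I \<Longrightarrow> markov_f (Q i) = 0"
  obtains g g' where "markov_biholo g g'" "\<And>i. i \<in> I \<Longrightarrow> g (P i) = Q i"
proof -
  have "\<exists>c s. c^2 - (9 * (of_nat n)^2 - 4) * s^2 = 1 \<and> (\<forall>i\<in>I. k i = n \<longrightarrow> markov_shear c s (P i) = Q i)" for n
  proof (cases "n \<in> k ` I")
    case True
    then obtain i where i: "i \<in> I" "n = k i" by blast
    obtain c s where cs: "c^2 - (9 * (P i $ 1)^2 - 4) * s^2 = 1" "markov_shear c s (P i) = Q i"
      using markov_shear_transitive[of "P i" "Q i"] P[OF i(1)] Q[OF i(1)] pos[OF i(1)] by auto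
    then show ?thesis
      using inj_onD[OF inj _ _ i(1)] i P(1)[OF i(1)] by (intro exI[of _ c] exI[of _ s]) auto
  next
    case False
    \<comment> \<open>On fibres without a prescribed point the identity shear is used.\<close>
    then show ?thesis by (intro exI[of _ 1] exI[of _ 0]) auto
  qed
  then obtain c s where cs: "\<And>n. (c n)^2 - (9 * (of_nat n)^2 - 4) * (s n)^2 = (1 :: complex)"
      "\<And>i. i \<in> I \<Longrightarrow> markov_shear (c (k i)) (s (k i)) (P i) = Q i"
    by metis
  obtain g g' where "markov_biholo g g'" "\<And>p n. p$1 = of_nat n \<Longrightarrow> g p = markov_shear (c n) (s n) p"
    using markov_shear_interpolation[of c s] cs(1) by blast
  then show thesis using that P(1) cs(2) by metis
qed

lemma exists_markov_third:
  obtains z where "markov_f (mk3 x y z) = 0"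
proof
  \<comment> \<open>A root of the discriminant of the equation read as a quadratic in z.\<close>
  define d where "d = csqrt (9 * x^2 * y^2 - 4 * (x^2 + y^2))"
  have "d^2 = 9 * x^2 * y^2 - 4 * (x^2 + y^2)" by (simp add: d_def)
  then show "markov_f (mk3 x y ((3 * x * y + d) / 2)) = 0"
    by (simp add: markov_f_def power_divide field_simps) algebra
qed

lemma exists_extension_biholo:
  assumes j: "j \<in> nat_triples \<rightarrow> nat_triples" "inj_on j nat_triples"
  obtains F F' where "markov_biholo F F'" "\<And>a. a \<in> nat_triples \<Longrightarrow> F (triple_point a) = triple_point (j a)"
proof -
  define third :: "nat \<times> nat \<times> nat \<Rightarrow> complex" where "third = (\<lambda>(x, y, z). of_nat z)"
  define X Y :: "nat \<times> nat \<times> nat \<Rightarrow> complex"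
    where "X a = of_nat (spread 0 a)" and "Y a = of_nat (spread 1 a)" for a
  obtain g0 g0' where g0: "markov_biholo g0 g0'"
      "\<And>a. a \<in> nat_triples \<Longrightarrow> g0 (triple_point a) = mk3 (X a) (Y a) (third a)"
    by (rule exists_spreading_biholo) (auto simp: X_def Y_def third_def)
  have surf: "markov_f (mk3 (X a) (Y a) (third a)) = 0" if "a \<in> nat_triples" for a
    using g0 triple_point_surface[OF that] that unfolding markov_biholo_def markov_entire_def by metis
  \<comment> \<open>The intermediate point shares its x-coordinate with the source and its
    y-coordinate with the target.\<close>
  have "\<exists>z. markov_f (mk3 (X a) (Y (j a)) z) = 0" for a
    by (rule exists_markov_third) blast
  then obtain \<zeta> where \<zeta>: "\<And>a. markov_f (mk3 (X a) (Y (j a)) (\<zeta> a)) = 0"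
    by metis
  obtain g1 g1' where g1: "markov_biholo g1 g1'"
      "\<And>a. a \<in> nat_triples \<Longrightarrow> g1 (mk3 (X a) (Y a) (third a)) = mk3 (X a) (Y (j a)) (\<zeta> a)"
  proof (rule exists_moving_biholo[of "spread 0" nat_triples "\<lambda>a. mk3 (X a) (Y a) (third a)"
        "\<lambda>a. mk3 (X a) (Y (j a)) (\<zeta> a)"])
    show "inj_on (spread 0) nat_triples" by (rule inj_on_spread) simp
    show "0 < spread 0 a" if "a \<in> nat_triples" for a
      using that by (rule spread_pos)
    show "mk3 (X a) (Y a) (third a) $ 1 = of_nat (spread 0 a)" for a by (simp add: X_def)
    show "mk3 (X a) (Y (j a)) (\<zeta> a) $ 1 = of_nat (spread 0 a)" for a by (simp add: X_def)
    show "markov_f (mk3 (X a) (Y a) (third a)) = 0" if "a \<in> nat_triples" for a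
      using that by (rule surf)
    show "markov_f (mk3 (X a) (Y (j a)) (\<zeta> a)) = 0" for a
      by (rule \<zeta>)
  qed (rule that)
  have rot_f: "markov_f (markov_rot p) = markov_f p" for p
    using markov_entire_rot by (simp add: markov_entire_def)
  \<comment> \<open>The flow of y needs the y-coordinates of the targets to be distinct; here the
    injectivity of j enters.\<close>
  have inj: "inj_on (\<lambda>a. spread 1 (j a)) nat_triples"
    using comp_inj_on[OF j(2) inj_on_subset[OF inj_on_spread[of 1]]] j(1) by (auto simp: o_def)
  obtain g2 g2' where g2: "markov_biholo g2 g2'"
      "\<And>a. a \<in> nat_triples \<Longrightarrow> g2 (markov_rot (mk3 (X a) (Y (j a)) (\<zeta> a))) =
           markov_rot (mk3 (X (j a)) (Y (j a)) (third (j a)))"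
  proof (rule exists_moving_biholo[OF inj, of "\<lambda>a. markov_rot (mk3 (X a) (Y (j a)) (\<zeta> a))"
        "\<lambda>a. markov_rot (mk3 (X (j a)) (Y (j a)) (third (j a)))"])
    show "0 < spread 1 (j a)" if "a \<in> nat_triples" for a
      using that j(1) by (intro spread_pos) auto
    show "markov_rot (mk3 (X a) (Y (j a)) (\<zeta> a)) $ 1 = of_nat (spread 1 (j a))" for a
      by (simp add: Y_def markov_rot_def)
    show "markov_rot (mk3 (X (j a)) (Y (j a)) (third (j a))) $ 1 = of_nat (spread 1 (j a))" for a
      by (simp add: Y_def markov_rot_def)
    show "markov_f (markov_rot (mk3 (X a) (Y (j a)) (\<zeta> a))) = 0" for a
      by (simp only: rot_f \<zeta>)
    show "markov_f (markov_rot (mk3 (X (j a)) (Y (j a)) (third (j a)))) = 0" if "a \<in> nat_triples" for a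
      unfolding rot_f using that j(1) by (intro surf) auto
  qed (rule that)
  have rot: "markov_biholo (markov_rot \<circ> markov_rot) markov_rot"
    by (rule markov_biholo_sym[OF markov_biholo_rot])
  have rot3: "markov_rot (markov_rot (markov_rot q)) = q" for q
    by (simp add: markov_rot_def vec3_eq_iff)
  \<comment> \<open>Read from the right: spread, flow of x, flow of y conjugated by rotations, and
    undo the spreading.\<close>
  let ?F = "g0' \<circ> ((markov_rot \<circ> markov_rot) \<circ> (g2 \<circ> (markov_rot \<circ> (g1 \<circ> g0))))"
  have "?F (triple_point a) = triple_point (j a)" if a: "a \<in> nat_triples" for a
  proof -
    have "j a \<in> nat_triples" using j(1) a by auto
    then have "g0' (mk3 (X (j a)) (Y (j a)) (third (j a))) = triple_point (j a)"
      using g0 unfolding markov_biholo_def by metis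
    then show ?thesis by (simp add: g0(2) g1(2) g2(2) a rot3)
  qed
  moreover have "\<exists>F'. markov_biholo ?F F'"
    using markov_biholo_comp[OF markov_biholo_sym[OF g0(1)] markov_biholo_comp[OF rot
        markov_biholo_comp[OF g2(1) markov_biholo_comp[OF markov_biholo_rot
        markov_biholo_comp[OF g1(1) g0(1)]]]]] by blast
  ultimately show thesis using that by blast
qed

theorem theorem1p6:
  shows "tame markov_surface markov_reg markov_G ordered_markov_triples"
  unfolding tame_def
proof (intro conjI allI impI ballI)
  show "infinite ordered_markov_triples"
    unfolding ordered_markov_triples_eq
    using infinite_nat_triples inj_on_subset[OF inj_triple_point] by (auto dest: finite_imageD)
  show reg: "ordered_markov_triples \<subseteq> markov_reg"
    using triple_point_regular by (auto simp: ordered_markov_triples_eq)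
  have "closed ordered_markov_triples"
    by (rule discrete_imp_closed[of 1]) (auto simp: ordered_markov_triples_eq dest: triple_point_dist)
  then show "closedin (top_of_set markov_surface) ordered_markov_triples"
    using reg by (intro closed_subset) (auto simp: markov_reg_def)
  show "\<exists>e>0. ball a e \<inter> ordered_markov_triples = {a}" if "a \<in> ordered_markov_triples" for a
    using that by (intro exI[of _ 1]) (auto simp: ordered_markov_triples_eq dest: triple_point_dist)
next
  fix \<iota>
  assume \<iota>: "\<iota> ` ordered_markov_triples \<subseteq> ordered_markov_triples \<and> inj_on \<iota> ordered_markov_triples"
  then have "\<forall>a\<in>nat_triples. \<exists>b\<in>nat_triples. \<iota> (triple_point a) = triple_point b"
    by (auto simp: ordered_markov_triples_eq)
  then obtain j where j: "\<And>a. a \<in> nat_triples \<Longrightarrow> j a \<in> nat_triples \<and> \<iota> (triple_point a) = triple_point (j a)"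
    by metis
  have "inj_on j nat_triples"
  proof (rule inj_onI)
    fix a b
    assume ab: "a \<in> nat_triples" "b \<in> nat_triples" "j a = j b"
    then have "\<iota> (triple_point a) = \<iota> (triple_point b)" using j by metis
    then have "triple_point a = triple_point b"
      using \<iota> ab by (auto simp: ordered_markov_triples_eq dest: inj_onD)
    then show "a = b" using inj_triple_point by (simp add: inj_eq)
  qed
  then obtain F F' where "markov_biholo F F'" "\<And>a. a \<in> nat_triples \<Longrightarrow> F (triple_point a) = triple_point (j a)"
    using exists_extension_biholo[of j] j by auto
  then show "\<exists>F\<in>markov_G. \<forall>a\<in>ordered_markov_triples. F a = \<iota> a"
    using j markov_biholo_in_G by (intro bexI[of _ F]) (auto simp: ordered_markov_triples_eq)
qed

end
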